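(* For any positive integer $k$, there exist two distributions of the value profile $(v_1,v_2)$ of two bidders which satisfy the Crémer–McLean condition and which, with high probabilities, cannot be distinguished by $k$ samples. Moreover, no single auction (dominant strategy incentive compatible, and interim individually rational under both distributions) extracts any constant fraction of the optimal revenue under both distributions.
   Context: A single item is sold to $n$ bidders (here $n=2$) whose private values $v_1,\dots,v_n$ are drawn from a joint, possibly correlated, distribution $D$ with finite support; $T_i$ denotes the support of $v_i$. A sample is a value profile drawn independently from the underlying distribution; distinguishing the two distributions means identifying, from the samples, which of the two is the underlying one. An auction maps each reported value profile $v=(v_1,\dots,v_n)$ to allocation probabilities $x_i(v)\in[0,1]$ with $\sum_i x_i(v)\le 1$ and payments $p_i(v)\in\mathbb R$ (possibly negative); bidder $i$'s utility is $v_ix_i-p_i$. It is dominant strategy incentive compatible (DSIC) if $v_i x_i(v_i,v_{-i})-p_i(v_i,v_{-i})\ge v_i x_i(v_i',v_{-i})-p_i(v_i',v_{-i})$ for all $i,v_i,v_i',v_{-i}$. It is interim individually rational (interim IR) under $D$ if $\mathbf E_{v_{-i}}[v_i x_i(v_i,v_{-i})-p_i(v_i,v_{-i})\mid v_i]\ge 0$ for all $i$ and $v_i\in T_i$, where $v_{-i}$ is drawn from the conditional distribution under $D$ given $v_i$. The revenue of an auction under $D$ is the sum of the expected payments it collects from all bidders; the optimal revenue under $D$ is the maximum revenue under $D$ over auctions that are DSIC and interim IR under $D$. Crémer–McLean condition for $D$: for each bidder $i$, the $|T_i|$ vectors $D_{i,v_i}=(D(v_{-i}\mid v_i))_{v_{-i}}$,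 $v_i\in T_i$, are linearly independent. *)

theory Defs
  imports "HOL-Probability.Probability"
begin

type_synonym 'i profile = "'i \<Rightarrow> real"

definition valuation_dist :: "'i::finite profile pmf \<Rightarrow> bool" where
  "valuation_dist D \<longleftrightarrow> finite (set_pmf D) \<and> (\<forall>v\<in>set_pmf D. \<forall>i. 0 \<le> v i)"

definition types :: "'i profile pmf \<Rightarrow> 'i \<Rightarrow> real set" where
  "types D i = (\<lambda>v. v i) ` set_pmf D"

text \<open>
  The conditional distribution of \<open>v\<^sub>-\<^sub>i\<close> given \<open>v\<^sub>i = t\<close>, meaningful for \<open>t \<in> types D i\<close>.
  The profile \<open>v\<^sub>-\<^sub>i\<close> of the others is a function that is \<open>undefined\<close> at \<open>i\<close>; combined with
  a value \<open>t\<close> of bidder \<open>i\<close>, it gives the full profile \<open>u(i := t)\<close>.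
\<close>

definition others_given :: "'i profile pmf \<Rightarrow> 'i \<Rightarrow> real \<Rightarrow> 'i profile pmf" where
  "others_given D i t = map_pmf (\<lambda>v. restrict v (- {i})) (cond_pmf D {v. v i = t})"

text \<open>
  Linear independence of the vectors \<open>D\<^sub>i\<^sub>,\<^sub>t\<close> as a family indexed by \<open>t\<close> (so repeated vectors
  count as dependent). The type sets are finite for the distributions considered.
\<close>

definition cremer_mclean :: "'i profile pmf \<Rightarrow> bool" where
  "cremer_mclean D \<longleftrightarrow>
     (\<forall>i. \<forall>c :: real \<Rightarrow> real.
        (\<forall>u. (\<Sum>t\<in>types D i. c t * pmf (others_given D i t) u) = 0) \<longrightarrow>
        (\<forall>t\<in>types D i. c t = 0))"

record 'i auction =
  alloc :: "'i \<Rightarrow> 'i profile \<Rightarrow> real"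
  pay :: "'i \<Rightarrow> 'i profile \<Rightarrow> real"

definition feasible :: "'i::finite auction \<Rightarrow> bool" where
  "feasible A \<longleftrightarrow>
     (\<forall>v. (\<forall>i. 0 \<le> alloc A i v \<and> alloc A i v \<le> 1) \<and> (\<Sum>i\<in>UNIV. alloc A i v) \<le> 1)"

definition utility :: "'i auction \<Rightarrow> 'i \<Rightarrow> real \<Rightarrow> 'i profile \<Rightarrow> real" where
  "utility A i t b = t * alloc A i b - pay A i b"

definition dsic :: "'i auction \<Rightarrow> bool" where
  "dsic A \<longleftrightarrow> (\<forall>i v t'. utility A i (v i) v \<ge> utility A i (v i) (v(i := t')))"

definition interim_ir :: "'i profile pmf \<Rightarrow> 'i auction \<Rightarrow> bool" where
  "interim_ir D A \<longleftrightarrow>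
     (\<forall>i. \<forall>t\<in>types D i.
        measure_pmf.expectation (others_given D i t) (\<lambda>u. utility A i t (u(i := t))) \<ge> 0)"

definition revenue :: "'i::finite profile pmf \<Rightarrow> 'i auction \<Rightarrow> real" where
  "revenue D A = (\<Sum>i\<in>UNIV. measure_pmf.expectation D (pay A i))"

definition is_optimal_revenue :: "'i::finite profile pmf \<Rightarrow> real \<Rightarrow> bool" where
  "is_optimal_revenue D R \<longleftrightarrow>
     (\<exists>A. feasible A \<and> dsic A \<and> interim_ir D A \<and> revenue D A = R) \<and>
     (\<forall>A. feasible A \<and> dsic A \<and> interim_ir D A \<longrightarrow> revenue D A \<le> R)"

text \<open>
  A possibly randomized procedure \<open>f\<close> sees \<open>k\<close> independent samples and answers \<open>True\<close> for \<open>D\<close>,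
  \<open>False\<close> for \<open>D'\<close>. Its success probabilities under \<open>D\<close> and under \<open>D'\<close> sum to exactly 1 if it
  ignores the samples. Exceeding this by at most \<open>\<delta>\<close>, for every \<open>f\<close>, says that the two
  \<open>k\<close>-sample distributions are at total variation distance at most \<open>\<delta>\<close>.
\<close>

definition indistinguishable :: "nat \<Rightarrow> real \<Rightarrow> 'i profile pmf \<Rightarrow> 'i profile pmf \<Rightarrow> bool" where
  "indistinguishable k \<delta> D D' \<longleftrightarrow>
     (\<forall>f :: 'i profile list \<Rightarrow> bool pmf.
        pmf (bind_pmf (replicate_pmf k D) f) True
          + pmf (bind_pmf (replicate_pmf k D') f) False \<le> 1 + \<delta>)"

end

theory Submission
  imports Defs
begin

text \<open>
  Bidder 1 has an equal-revenue value \<open>2\<^sup>i\<close>, \<open>i \<le> n\<close>, bidder 2 a value \<open>2\<^sup>-\<^sup>j\<close> that is almost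
  uniform and independent of it: conditionally on \<open>i\<close>, the index \<open>j\<close> has probability
  \<open>(1 - e) / (n + 1) + e [i = j]\<close>. For every small \<open>e \<noteq> 0\<close> this matrix is invertible, so the seller
  can charge bidder 1 an amount depending on \<open>j\<close> only whose conditional expectation is exactly
  \<open>2\<^sup>i\<close>; the optimal revenue is the full surplus \<open>n / 2 + 1\<close>. The distributions for \<open>e\<close> and \<open>-e\<close>
  are close, and their average is a product distribution. An auction that is interim IR under both
  is interim IR for bidder 1 under the product, where an equal-revenue bidder pays at most 1 on
  average. Hence the two revenues sum up to at most 4, whatever \<open>n\<close> is.
\<close>

section \<open>Interim quantities as finite sums\<close>

lemma cond_event_nonempty:
  assumes "t \<in> types D i"
  shows "set_pmf D \<inter> {v. v i = t} \<noteq> {}"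
  using assms by (auto simp: types_def)

lemma prob_type_pos:
  assumes "t \<in> types D i"
  shows "0 < measure_pmf.prob D {v. v i = t}"
  using cond_event_nonempty[OF assms] by (auto intro: measure_pmf_posI)

text \<open>Given \<open>v i = t\<close>, the restriction to the other bidders determines the whole
  profile, so \<open>v(i := t)\<close> is the only preimage of positive conditional
  probability.\<close>

lemma pmf_others_given:
  assumes "t \<in> types D i"
  shows "pmf (others_given D i t) (restrict v (- {i})) =
    pmf D (v(i := t)) / measure_pmf.prob D {v. v i = t}"
proof -
  let ?C = "cond_pmf D {v. v i = t}"
  have ne: "set_pmf D \<inter> {v. v i = t} \<noteq> {}" by (rule cond_event_nonempty[OF assms])
  have "pmf (others_given D i t) (restrict v (- {i})) =
      measure_pmf.prob ?C ((\<lambda>w. restrict w (- {i})) -` {restrict v (- {i})})"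
    by (simp add: others_given_def pmf_map)
  also have "\<dots> = measure_pmf.prob ?C {v(i := t)}"
  proof (rule measure_prob_cong_0)
    fix w
    assume "w \<in> (\<lambda>w. restrict w (- {i})) -` {restrict v (- {i})} - {v(i := t)}"
    then have eq: "restrict w (- {i}) = restrict v (- {i})" and neq: "w \<noteq> v(i := t)" by auto
    have "w l = v l" if "l \<noteq> i" for l
      using fun_cong[OF eq, of l] that by simp
    then have "w i \<noteq> t" using neq by auto
    then show "pmf ?C w = 0" by (simp add: pmf_cond[OF ne])
  next
    fix w
    assume "w \<in> {v(i := t)} - (\<lambda>w. restrict w (- {i})) -` {restrict v (- {i})}"
    then show "pmf ?C w = 0" by (auto simp: restrict_def fun_eq_iff split: if_splits)
  qed
  also have "\<dots> = pmf D (v(i := t)) / measure_pmf.prob D {v. v i = t}"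
    by (simp add: measure_pmf_single pmf_cond[OF ne])
  finally show ?thesis .
qed

text \<open>Each conditional vector is a positive multiple of a row of joint probabilities, and such
  scaling does not affect linear independence. The joint probabilities can therefore be used
  directly.\<close>

lemma cremer_mcleanI:
  assumes "\<And>i c. (\<And>v. (\<Sum>t\<in>types D i. c t * pmf D (v(i := t))) = 0) \<Longrightarrow> \<forall>t\<in>types D i. c t = 0"
  shows "cremer_mclean D"
  unfolding cremer_mclean_def
proof (intro allI impI ballI)
  fix i t and c :: "real \<Rightarrow> real"
  assume ker: "\<forall>u. (\<Sum>t\<in>types D i. c t * pmf (others_given D i t) u) = 0" and t: "t \<in> types D i"
  let ?M = "\<lambda>t. measure_pmf.prob D {v. v i = t}"
  have "(\<Sum>t\<in>types D i. c t / ?M t * pmf D (v(i := t))) = 0" for v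
  proof -
    have "(\<Sum>t\<in>types D i. c t / ?M t * pmf D (v(i := t))) =
        (\<Sum>t\<in>types D i. c t * pmf (others_given D i t) (restrict v (- {i})))"
      by (rule sum.cong) (simp_all add: pmf_others_given)
    then show ?thesis using ker by simp
  qed
  then have "c t / ?M t = 0" using assms[where i = i and c = "\<lambda>t. c t / ?M t"] t by blast
  then show "c t = 0" using prob_type_pos[OF t] by simp
qed

lemma expectation_others_given:
  fixes D :: "'i profile pmf" and F :: "'i profile \<Rightarrow> real"
  assumes fin: "finite (set_pmf D)" and t: "t \<in> types D i"
  shows "measure_pmf.expectation (others_given D i t) (\<lambda>u. F (u(i := t))) =
    (\<Sum>v\<in>{v\<in>set_pmf D. v i = t}. pmf D v * F v) / measure_pmf.prob D {v. v i = t}"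
proof -
  let ?C = "cond_pmf D {v. v i = t}"
  have ne: "set_pmf D \<inter> {v. v i = t} \<noteq> {}" by (rule cond_event_nonempty[OF t])
  \<comment> \<open>The update overwrites the \<open>undefined\<close> that restriction leaves at
    \<open>i\<close>.\<close>
  have upd: "(restrict v (- {i}))(i := v i) = v" for v :: "'i profile" by (auto simp: fun_eq_iff)
  have "measure_pmf.expectation (others_given D i t) (\<lambda>u. F (u(i := t))) =
      measure_pmf.expectation ?C (\<lambda>v. F ((restrict v (- {i}))(i := t)))"
    by (simp add: others_given_def)
  also have "\<dots> = (\<Sum>v\<in>{v\<in>set_pmf D. v i = t}. pmf ?C v * F ((restrict v (- {i}))(i := t)))"
    by (subst integral_measure_pmf_real[where A = "{v\<in>set_pmf D. v i = t}"])
      (use fin in \<open>auto simp: set_cond_pmf[OF ne] mult.commute\<close>)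
  also have "\<dots> = (\<Sum>v\<in>{v\<in>set_pmf D. v i = t}. pmf D v * F v / measure_pmf.prob D {v. v i = t})"
  proof (rule sum.cong)
    fix v
    assume "v \<in> {v\<in>set_pmf D. v i = t}"
    then have "v i = t" by simp
    with upd[of v] show "pmf ?C v * F ((restrict v (- {i}))(i := t)) =
        pmf D v * F v / measure_pmf.prob D {v. v i = t}"
      by (simp only:) (simp add: pmf_cond[OF ne])
  qed simp
  finally show ?thesis by (simp add: sum_divide_distrib)
qed

lemma interim_ir_iff:
  fixes D :: "'i profile pmf"
  assumes "finite (set_pmf D)"
  shows "interim_ir D A \<longleftrightarrow>
    (\<forall>i. \<forall>t\<in>types D i. 0 \<le> (\<Sum>v\<in>{v\<in>set_pmf D. v i = t}. pmf D v * utility A i t v))"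
proof -
  have "0 \<le> measure_pmf.expectation (others_given D i t) (\<lambda>u. utility A i t (u(i := t))) \<longleftrightarrow>
      0 \<le> (\<Sum>v\<in>{v\<in>set_pmf D. v i = t}. pmf D v * utility A i t v)" if "t \<in> types D i" for i t
    using prob_type_pos[OF that]
    by (simp add: expectation_others_given[OF assms that] zero_le_divide_iff)
  then show ?thesis by (auto simp: interim_ir_def)
qed

text \<open>Summing the interim constraints over all types of bidder \<open>i\<close> shows that the
  ex-ante expected utility is nonnegative.\<close>

lemma expected_pay_le:
  fixes D :: "'i profile pmf"
  assumes fin: "finite (set_pmf D)" and ir: "interim_ir D A"
  shows "measure_pmf.expectation D (pay A i) \<le> measure_pmf.expectation D (\<lambda>v. v i * alloc A i v)"
proof -
  have "0 \<le> (\<Sum>t\<in>types D i. \<Sum>v\<in>{v\<in>set_pmf D. v i = t}. pmf D v * utility A i t v)"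
    using ir unfolding interim_ir_iff[OF fin] by (intro sum_nonneg[of "types D i"]) blast
  also have "\<dots> = (\<Sum>t\<in>types D i. \<Sum>v\<in>{v\<in>set_pmf D. v i = t}. pmf D v * utility A i (v i) v)"
    by (intro sum.cong) auto
  also have "\<dots> = (\<Sum>v\<in>set_pmf D. pmf D v * utility A i (v i) v)"
    using sum.image_gen[OF fin, of "\<lambda>v. pmf D v * utility A i (v i) v" "\<lambda>v. v i"]
    by (simp add: types_def)
  also have "\<dots> = measure_pmf.expectation D (\<lambda>v. v i * alloc A i v) - measure_pmf.expectation D (pay A i)"
    by (simp add: integral_measure_pmf_real[OF fin] utility_def algebra_simps sum_subtractf)
  finally show ?thesis by simp
qed

section \<open>Indistinguishability from closeness of single samples\<close>

text \<open>Hybrid argument: the samples are exchanged one at a time. With the other samples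
  averaged out, the answer probability is a [0,1]-valued function of a single sample, so each
  exchange costs at most \<open>\<tau>\<close>.\<close>

lemma pmf_bind_replicate_le:
  fixes D D' :: "'a pmf"
  assumes close: "\<And>g :: 'a \<Rightarrow> real. (\<And>x. 0 \<le> g x \<and> g x \<le> 1) \<Longrightarrow>
    measure_pmf.expectation D g \<le> measure_pmf.expectation D' g + \<tau>"
  shows "pmf (bind_pmf (replicate_pmf k D) f) b \<le> pmf (bind_pmf (replicate_pmf k D') f) b + real k * \<tau>"
proof (induction k arbitrary: f)
  case 0
  then show ?case by simp
next
  case (Suc k)
  let ?g = "\<lambda>E x. pmf (bind_pmf (replicate_pmf k E) (\<lambda>xs. f (x # xs))) b"
  have step: "pmf (bind_pmf (replicate_pmf (Suc k) E) f) b = measure_pmf.expectation E (?g E)"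
    for E :: "'a pmf"
    by (simp add: bind_assoc_pmf bind_return_pmf pmf_bind)
  have int: "integrable (measure_pmf E) (?g E')" for E E' :: "'a pmf"
    by (intro measure_pmf.integrable_const_bound[where B = 1]) (auto simp: pmf_le_1)
  \<comment> \<open>The last \<open>k\<close> samples are exchanged first, for each fixed first
    sample; \<open>close\<close> then exchanges the first one.\<close>
  have "measure_pmf.expectation D (?g D) \<le> measure_pmf.expectation D (\<lambda>x. ?g D' x + real k * \<tau>)"
    using int by (intro integral_mono) (auto intro: Suc.IH)
  also have "\<dots> = measure_pmf.expectation D (?g D') + real k * \<tau>"
    using int by simp
  also have "measure_pmf.expectation D (?g D') \<le> measure_pmf.expectation D' (?g D') + \<tau>"
    by (intro close) (simp add: pmf_le_1)
  finally show ?case unfolding step by (simp add: algebra_simps)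
qed

lemma indistinguishableI:
  fixes D D' :: "'i profile pmf"
  assumes close: "\<And>g :: 'i profile \<Rightarrow> real. (\<And>x. 0 \<le> g x \<and> g x \<le> 1) \<Longrightarrow>
    measure_pmf.expectation D g \<le> measure_pmf.expectation D' g + \<tau>"
    and "real k * \<tau> \<le> \<delta>"
  shows "indistinguishable k \<delta> D D'"
  unfolding indistinguishable_def
proof
  fix f :: "'i profile list \<Rightarrow> bool pmf"
  have "pmf p False = 1 - pmf p True" for p :: "bool pmf"
    using pmf_False_conv_True by blast
  moreover have "pmf (bind_pmf (replicate_pmf k D) f) True
      \<le> pmf (bind_pmf (replicate_pmf k D') f) True + real k * \<tau>"
    using close by (rule pmf_bind_replicate_le)
  ultimately show "pmf (bind_pmf (replicate_pmf k D) f) True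
      + pmf (bind_pmf (replicate_pmf k D') f) False \<le> 1 + \<delta>"
    using assms(2) by (smt (verit))
qed

section \<open>The perturbed product distributions\<close>

text \<open>Values of bidder 2 are distinct for distinct \<open>j\<close>, so they reveal the index,
  yet never exceed 1, so they add little revenue.\<close>

definition profile2 :: "nat \<Rightarrow> nat \<Rightarrow> 2 profile" where
  "profile2 i j = (\<lambda>_. 1 / 2 ^ j)(1 := 2 ^ i)"

lemma profile2_simps [simp]: "profile2 i j 1 = 2 ^ i" "profile2 i j 2 = 1 / 2 ^ j"
  by (simp_all add: profile2_def)

lemma profile2_upd: "(profile2 i j)(1 := 2 ^ l) = profile2 l j" "(profile2 i j)(2 := 1 / 2 ^ l) = profile2 i l"
proof -
  show "(profile2 i j)(1 := 2 ^ l) = profile2 l j" by (simp add: profile2_def)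
  show "(profile2 i j)(2 := 1 / 2 ^ l) = profile2 i l"
  proof
    fix x :: 2
    show "((profile2 i j)(2 := 1 / 2 ^ l)) x = profile2 i l x"
      using exhaust_2[of x] by (auto simp: profile2_def)
  qed
qed

lemma profile2_eq_iff [simp]: "profile2 i j = profile2 i' j' \<longleftrightarrow> i = i' \<and> j = j'"
proof
  assume eq: "profile2 i j = profile2 i' j'"
  show "i = i' \<and> j = j'" using fun_cong[OF eq, of 1] fun_cong[OF eq, of 2] by simp
qed simp

text \<open>The tail probabilities are \<open>2\<^sup>-\<^sup>i\<close>; the atom at \<open>n\<close> carries the truncated tail.\<close>

definition er_weight :: "nat \<Rightarrow> nat \<Rightarrow> real" where
  "er_weight n i = (if i < n then 1 / 2 ^ Suc i else 1 / 2 ^ n)"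

lemma er_weight_pos: "0 < er_weight n i"
  by (simp add: er_weight_def)

lemma sum_er_weight: "(\<Sum>i\<le>n. er_weight n i * f i) = (\<Sum>i<n. f i / 2 ^ Suc i) + f n / 2 ^ n"
  by (simp add: er_weight_def lessThan_Suc_atMost[symmetric])

lemma sum_er_weight_one: "(\<Sum>i\<le>n. er_weight n i) = 1"
proof -
  have "(\<Sum>i<n. 1 / 2 ^ Suc i) + 1 / 2 ^ n = (1 :: real)" by (induction n) (simp_all add: field_simps)
  then show ?thesis using sum_er_weight[of n "\<lambda>_. 1"] by simp
qed

text \<open>Here \<open>X\<close> and \<open>Q\<close> stand for allocation and payment of type
  \<open>2 ^ i\<close>; the hypotheses are IR of the lowest type and the incentive not to report the
  next lower type. By summation by parts, the payment increment at \<open>Suc i\<close> is weighted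
  by the tail probability \<open>1 / 2 ^ Suc i\<close>, which cancels the value
  \<open>2 ^ Suc i\<close>, and the allocation increments telescope.\<close>

lemma equal_revenue_bound:
  fixes Q X :: "nat \<Rightarrow> real"
  assumes "Q 0 \<le> X 0" and "\<And>i. i < n \<Longrightarrow> Q (Suc i) - Q i \<le> 2 ^ Suc i * (X (Suc i) - X i)"
  shows "(\<Sum>i\<le>n. er_weight n i * Q i) \<le> X n"
proof -
  have "(\<Sum>i<m. Q i / 2 ^ Suc i) + Q m / 2 ^ m \<le> X m" if "m \<le> n" for m
    using that
  proof (induction m)
    case 0
    then show ?case using assms(1) by simp
  next
    case (Suc m)
    have "(Q (Suc m) - Q m) / 2 ^ Suc m \<le> X (Suc m) - X m"
      using assms(2)[of m] Suc.prems by (simp add: pos_divide_le_eq mult.commute)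
    then show ?case using Suc by (simp add: diff_divide_distrib)
  qed
  then show ?thesis by (simp add: sum_er_weight)
qed

text \<open>The joint probability of the indices. It is affine in \<open>e\<close> and its row sums
  do not depend on \<open>e\<close>, which allows negative \<open>e\<close> as well.\<close>

definition cell :: "nat \<Rightarrow> real \<Rightarrow> nat \<Rightarrow> nat \<Rightarrow> real" where
  "cell n e i j = er_weight n i * ((1 - e) / real (Suc n) + (if i = j then e else 0))"

definition perturbed :: "nat \<Rightarrow> real \<Rightarrow> 2 profile pmf" where
  "perturbed n e = map_pmf (case_prod profile2)
    (embed_pmf (\<lambda>(i, j). if i \<le> n \<and> j \<le> n then cell n e i j else 0))"

lemma sum_cell_snd:
  assumes "i \<le> n"
  shows "(\<Sum>j\<le>n. cell n e i j * f j) = er_weight n i * ((1 - e) / real (Suc n) * (\<Sum>j\<le>n. f j) + e * f i)"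
proof -
  have "(\<Sum>j\<le>n. cell n e i j * f j) =
      (\<Sum>j\<le>n. er_weight n i * ((1 - e) / real (Suc n) * f j) + (if i = j then er_weight n i * (e * f j) else 0))"
    by (rule sum.cong) (auto simp: cell_def algebra_simps)
  also have "\<dots> = er_weight n i * ((1 - e) / real (Suc n) * (\<Sum>j\<le>n. f j)) + er_weight n i * (e * f i)"
    using assms by (simp add: sum.distrib sum_distrib_left)
  finally show ?thesis by (simp add: distrib_left)
qed

lemma sum_cell_snd_one:
  assumes "i \<le> n"
  shows "(\<Sum>j\<le>n. cell n e i j) = er_weight n i"
  using sum_cell_snd[OF assms, where f = "\<lambda>_. 1"] by simp

text \<open>Adding all \<open>n + 1\<close> equations gives \<open>(1 - e) + e = 1\<close> times the
  sum of \<open>d\<close>, so this sum vanishes and each equation reduces to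
  \<open>e * d j = 0\<close>.\<close>

lemma cell_kernel_trivial:
  fixes d :: "nat \<Rightarrow> real"
  assumes eq: "\<And>j. j \<le> n \<Longrightarrow> (1 - e) / real (Suc n) * (\<Sum>i\<le>n. d i) + e * d j = 0"
    and "e \<noteq> 0" "j \<le> n"
  shows "d j = 0"
proof -
  have "0 = (\<Sum>j\<le>n. (1 - e) / real (Suc n) * (\<Sum>i\<le>n. d i) + e * d j)"
    by (intro sum.neutral[symmetric] ballI eq) simp
  also have "\<dots> = (1 - e) * (\<Sum>i\<le>n. d i) + e * (\<Sum>j\<le>n. d j)"
    by (simp add: sum.distrib sum_distrib_left)
  finally have "(\<Sum>i\<le>n. d i) = 0" by (simp add: algebra_simps)
  then show ?thesis using eq[OF \<open>j \<le> n\<close>] \<open>e \<noteq> 0\<close> by simp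
qed

text \<open>The bound keeps all cells positive, and both conditions are invariant under replacing
  \<open>e\<close> by \<open>- e\<close>; \<open>e \<noteq> 0\<close> makes the matrix
  invertible.\<close>

locale perturbation =
  fixes n :: nat and e :: real
  assumes e_nz: "e \<noteq> 0" and e_small: "\<bar>e\<bar> \<le> 1 / (2 * real (Suc n))"
begin

lemma cell_pos: "0 < cell n e i j"
proof -
  have "\<bar>e\<bar> \<le> 1 / 2" by (rule order_trans[OF e_small]) (simp add: field_simps)
  then have "(1 / 2) / real (Suc n) \<le> (1 - e) / real (Suc n)"
    by (intro divide_right_mono) auto
  \<comment> \<open>The diagonal factor equals \<open>(1 + n * e) / (n + 1)\<close>, which is
    critical for negative \<open>e\<close>.\<close>
  moreover have "0 < (1 - e) / real (Suc n) + e"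
  proof -
    have "\<bar>e\<bar> * real n < 1"
      using e_small by (simp add: field_simps)
    then have "- e * real n < 1" by (smt (verit) mult_right_mono of_nat_0_le_iff)
    then show ?thesis by (simp add: field_simps)
  qed
  ultimately have "0 < (1 - e) / real (Suc n) + (if i = j then e else 0)"
    by (auto intro: less_le_trans[rotated])
  then show ?thesis by (simp add: cell_def er_weight_pos)
qed

lemma pmf_indices:
  "pmf (embed_pmf (\<lambda>(i, j). if i \<le> n \<and> j \<le> n then cell n e i j else 0)) (i, j) =
    (if i \<le> n \<and> j \<le> n then cell n e i j else 0)"
proof -
  let ?f = "\<lambda>(i, j). if i \<le> n \<and> j \<le> n then cell n e i j else 0"
  have "(\<integral>\<^sup>+ x. ennreal (?f x) \<partial>count_space UNIV) = (\<Sum>x\<in>{..n} \<times> {..n}. ennreal (?f x))"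
    by (rule nn_integral_count_space') (auto split: if_splits)
  also have "\<dots> = ennreal (\<Sum>x\<in>{..n} \<times> {..n}. ?f x)"
    by (intro sum_ennreal) (auto intro: less_imp_le[OF cell_pos])
  also have "(\<Sum>x\<in>{..n} \<times> {..n}. ?f x) = (\<Sum>i\<le>n. \<Sum>j\<le>n. cell n e i j)"
    by (simp add: sum.cartesian_product[symmetric])
  also have "\<dots> = 1"
    by (simp add: sum_cell_snd_one sum_er_weight_one)
  finally have "pmf (embed_pmf ?f) (i, j) = ?f (i, j)"
    by (intro pmf_embed_pmf) (auto intro: less_imp_le[OF cell_pos])
  then show ?thesis by simp
qed

lemma pmf_perturbed: "pmf (perturbed n e) (profile2 i j) = (if i \<le> n \<and> j \<le> n then cell n e i j else 0)"
proof -
  have "inj (case_prod profile2)" by (auto intro: injI)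
  from pmf_map_inj'[OF this, of _ "(i, j)"] show ?thesis
    by (simp add: perturbed_def pmf_indices)
qed

lemma set_perturbed: "set_pmf (perturbed n e) = case_prod profile2 ` ({..n} \<times> {..n})"
proof -
  have "set_pmf (embed_pmf (\<lambda>(i, j). if i \<le> n \<and> j \<le> n then cell n e i j else 0)) = {..n} \<times> {..n}"
    using cell_pos by (auto simp: set_pmf_eq pmf_indices less_imp_neq[symmetric] split: if_splits)
  then show ?thesis by (simp add: perturbed_def)
qed

lemma finite_perturbed: "finite (set_pmf (perturbed n e))"
  by (simp add: set_perturbed)

lemma types_perturbed:
  "types (perturbed n e) 1 = (\<lambda>i. 2 ^ i) ` {..n}" "types (perturbed n e) 2 = (\<lambda>j. 1 / 2 ^ j) ` {..n}"
proof -
  have "types (perturbed n e) l = (\<Union>i\<le>n. \<Union>j\<le>n. {profile2 i j l})" for l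
    by (auto simp: types_def set_perturbed image_def)
  then show "types (perturbed n e) 1 = (\<lambda>i. 2 ^ i) ` {..n}" "types (perturbed n e) 2 = (\<lambda>j. 1 / 2 ^ j) ` {..n}"
    by auto
qed

lemma expectation_perturbed:
  "measure_pmf.expectation (perturbed n e) F = (\<Sum>i\<le>n. \<Sum>j\<le>n. cell n e i j * F (profile2 i j))"
proof -
  have "inj_on (case_prod profile2) ({..n} \<times> {..n})" by (auto intro: inj_onI)
  then have "measure_pmf.expectation (perturbed n e) F =
      (\<Sum>x\<in>{..n} \<times> {..n}. F (case_prod profile2 x) * pmf (perturbed n e) (case_prod profile2 x))"
    by (subst integral_measure_pmf_real[OF finite_perturbed]) (assumption, simp add: set_perturbed sum.reindex)
  also have "\<dots> = (\<Sum>x\<in>{..n} \<times> {..n}. case x of (i, j) \<Rightarrow> cell n e i j * F (profile2 i j))"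
    by (rule sum.cong) (auto simp: pmf_perturbed)
  finally show ?thesis by (simp add: sum.cartesian_product)
qed

lemma valuation_dist_perturbed: "valuation_dist (perturbed n e)"
proof -
  have "0 \<le> profile2 i j l" for i j l
    by (simp add: profile2_def)
  then show ?thesis
    by (auto simp: valuation_dist_def finite_perturbed set_perturbed)
qed

section \<open>The Cremer-McLean condition\<close>

lemma cremer_mclean_perturbed: "cremer_mclean (perturbed n e)"
proof (rule cremer_mcleanI)
  fix i :: 2 and c :: "real \<Rightarrow> real"
  assume ker: "\<And>v. (\<Sum>t\<in>types (perturbed n e) i. c t * pmf (perturbed n e) (v(i := t))) = 0"
  consider "i = 1" | "i = 2" using exhaust_2 by blast
  then show "\<forall>t\<in>types (perturbed n e) i. c t = 0"
  proof cases
    case 1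
    \<comment> \<open>The weight varies with the summation index and is absorbed into the
      coefficients.\<close>
    let ?d = "\<lambda>l. c (2 ^ l) * er_weight n l"
    have "(1 - e) / real (Suc n) * (\<Sum>l\<le>n. ?d l) + e * ?d j = 0" if "j \<le> n" for j
    proof -
      have "0 = (\<Sum>l\<le>n. c (2 ^ l) * cell n e l j)"
        \<comment> \<open>The index 0 is a dummy: the update in \<open>ker\<close> overwrites
          it.\<close>
        using ker[of "profile2 0 j"] that
        by (simp add: 1 types_perturbed sum.reindex inj_on_def profile2_upd pmf_perturbed)
      also have "\<dots> = (\<Sum>l\<le>n. (1 - e) / real (Suc n) * ?d l + (if l = j then e * ?d l else 0))"
        by (rule sum.cong) (auto simp: cell_def algebra_simps)
      also have "\<dots> = (1 - e) / real (Suc n) * (\<Sum>l\<le>n. ?d l) + e * ?d j"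
        using that by (simp add: sum.distrib sum_distrib_left)
      finally show ?thesis by simp
    qed
    from cell_kernel_trivial[of n e ?d, OF this e_nz] show ?thesis
      using er_weight_pos[of n] by (auto simp: 1 types_perturbed less_imp_neq[symmetric])
  next
    case 2
    \<comment> \<open>Now the weight is a common factor of each equation and cancels.\<close>
    let ?d = "\<lambda>l. c (1 / 2 ^ l)"
    have "(1 - e) / real (Suc n) * (\<Sum>l\<le>n. ?d l) + e * ?d j = 0" if "j \<le> n" for j
    proof -
      have "0 = (\<Sum>l\<le>n. cell n e j l * c (1 / 2 ^ l))"
        using ker[of "profile2 j 0"] that
        by (simp add: 2 types_perturbed sum.reindex inj_on_def profile2_upd pmf_perturbed mult.commute)
      also have "\<dots> = er_weight n j * ((1 - e) / real (Suc n) * (\<Sum>l\<le>n. ?d l) + e * ?d j)"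
        by (rule sum_cell_snd[OF that])
      finally show ?thesis using er_weight_pos[of n j] by simp
    qed
    from cell_kernel_trivial[of n e ?d, OF this e_nz] show ?thesis
      by (auto simp: 2 types_perturbed)
  qed
qed

lemma interim_sum_perturbed:
  assumes "i \<le> n"
  shows "(\<Sum>v\<in>{v\<in>set_pmf (perturbed n e). v 1 = 2 ^ i}. pmf (perturbed n e) v * F v) =
    (\<Sum>j\<le>n. cell n e i j * F (profile2 i j))"
proof -
  have "{v\<in>set_pmf (perturbed n e). v 1 = 2 ^ i} = profile2 i ` {..n}"
    using assms by (auto simp: set_perturbed)
  moreover have "inj_on (profile2 i) {..n}" by (auto intro: inj_onI)
  ultimately show ?thesis
    using assms by (simp add: sum.reindex pmf_perturbed)
qed

section \<open>Revenue bounds and extraction of the full surplus\<close>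

lemma expected_pay_2_le:
  assumes "feasible A" and "interim_ir (perturbed n e) A"
  shows "measure_pmf.expectation (perturbed n e) (pay A 2) \<le> 1"
proof -
  have "measure_pmf.expectation (perturbed n e) (pay A 2)
      \<le> measure_pmf.expectation (perturbed n e) (\<lambda>v. v 2 * alloc A 2 v)"
    by (rule expected_pay_le[OF finite_perturbed assms(2)])
  also have "\<dots> \<le> (\<Sum>i\<le>n. \<Sum>j\<le>n. cell n e i j)"
    unfolding expectation_perturbed
  proof (intro sum_mono)
    fix i j
    have "1 / 2 ^ j * alloc A 2 (profile2 i j) \<le> 1"
      using assms(1) by (intro mult_le_one) (auto simp: feasible_def)
    from mult_left_mono[OF this less_imp_le[OF cell_pos]]
    show "cell n e i j * (profile2 i j 2 * alloc A 2 (profile2 i j)) \<le> cell n e i j"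
      by (simp only: profile2_simps mult_1_right)
  qed
  also have "\<dots> = 1" by (simp add: sum_cell_snd_one sum_er_weight_one)
  finally show ?thesis .
qed

text \<open>By interim IR the revenue is at most the welfare. Bidder 1 always has the larger value,
  since \<open>2 ^ i \<ge> 1 \<ge> 1 / 2 ^ j\<close>, so the welfare is at most the mean of
  \<open>2 ^ i\<close>.\<close>

lemma revenue_le_surplus:
  assumes A: "feasible A" and ir: "interim_ir (perturbed n e) A"
  shows "revenue (perturbed n e) A \<le> real n / 2 + 1"
proof -
  let ?E = "measure_pmf.expectation (perturbed n e)"
  have "revenue (perturbed n e) A = ?E (pay A 1) + ?E (pay A 2)"
    by (simp add: revenue_def sum_2)
  also have "\<dots> \<le> ?E (\<lambda>v. v 1 * alloc A 1 v) + ?E (\<lambda>v. v 2 * alloc A 2 v)"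
    by (intro add_mono expected_pay_le finite_perturbed ir)
  also have "\<dots> = (\<Sum>i\<le>n. \<Sum>j\<le>n. cell n e i j * (2 ^ i * alloc A 1 (profile2 i j) + 1 / 2 ^ j * alloc A 2 (profile2 i j)))"
    by (simp add: expectation_perturbed sum.distrib distrib_left)
  also have "\<dots> \<le> (\<Sum>i\<le>n. \<Sum>j\<le>n. cell n e i j * 2 ^ i)"
  proof (intro sum_mono mult_left_mono)
    fix i j
    have x: "0 \<le> alloc A 2 (profile2 i j)" "alloc A 1 (profile2 i j) + alloc A 2 (profile2 i j) \<le> 1"
      using A by (auto simp: feasible_def sum_2)
    have "1 / 2 ^ j \<le> (1 :: real)" by simp
    also have "(1 :: real) \<le> 2 ^ i" by simp
    finally have "1 / 2 ^ j * alloc A 2 (profile2 i j) \<le> 2 ^ i * alloc A 2 (profile2 i j)"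
      using x by (intro mult_right_mono) auto
    moreover have "2 ^ i * (alloc A 1 (profile2 i j) + alloc A 2 (profile2 i j)) \<le> 2 ^ i * (1 :: real)"
      using x by (intro mult_left_mono) auto
    ultimately show "2 ^ i * alloc A 1 (profile2 i j) + 1 / 2 ^ j * alloc A 2 (profile2 i j) \<le> 2 ^ i"
      by (simp add: distrib_left)
  qed (simp add: cell_pos less_imp_le)
  also have "\<dots> = (\<Sum>i\<le>n. er_weight n i * 2 ^ i)"
    by (simp add: sum_distrib_right[symmetric] sum_cell_snd_one)
  \<comment> \<open>Every \<open>i < n\<close> contributes 1/2, and the atom at \<open>n\<close>
    contributes 1.\<close>
  also have "\<dots> = real n / 2 + 1"
    by (simp add: sum_er_weight)
  finally show ?thesis .
qed

text \<open>
  The payment, as a function of bidder 2's value \<open>2\<^sup>-\<^sup>j\<close>, is the solution \<open>h\<close> of the system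
  \<open>(1 - e) / (n + 1) * (\<Sum>j\<le>n. h j) + e * h i = 2\<^sup>i\<close>.
\<close>

definition extractor :: "2 auction" where
  "extractor = \<lparr>alloc = (\<lambda>i v. if i = 1 then 1 else 0),
    pay = (\<lambda>i v. if i = 1 then (1 / v 2 - (1 - e) * ((\<Sum>j\<le>n. 2 ^ j) / real (Suc n))) / e else 0)\<rparr>"

text \<open>After division by \<open>er_weight n i\<close>, the expected payment of bidder 1 given
  type \<open>2 ^ i\<close> is exactly that type.\<close>

lemma sum_cell_extractor:
  assumes "i \<le> n"
  shows "(\<Sum>j\<le>n. cell n e i j * pay extractor 1 (profile2 i j)) = er_weight n i * 2 ^ i"
proof -
  define S :: real where "S = (\<Sum>j\<le>n. 2 ^ j)"
  define h where "h j = (2 ^ j - (1 - e) * (S / real (Suc n))) / e" for j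
  \<comment> \<open>The sum of the unknowns must equal \<open>S\<close>, as adding all equations of
    the system shows; the formula for \<open>h\<close> was obtained by inserting this.\<close>
  have "(\<Sum>j\<le>n. h j) = (S - real (Suc n) * ((1 - e) * (S / real (Suc n)))) / e"
    by (simp add: h_def sum_divide_distrib[symmetric] sum_subtractf S_def)
  also have "\<dots> = S"
    using e_nz by (simp add: field_simps del: of_nat_Suc)
  finally have "(1 - e) / real (Suc n) * (\<Sum>j\<le>n. h j) + e * h i = 2 ^ i"
    using e_nz by (simp add: h_def)
  then have "(\<Sum>j\<le>n. cell n e i j * h j) = er_weight n i * 2 ^ i"
    by (simp only: sum_cell_snd[OF assms])
  then show ?thesis by (simp add: extractor_def h_def S_def)
qed

lemma is_optimal_revenue_perturbed: "is_optimal_revenue (perturbed n e) (real n / 2 + 1)"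
proof -
  have "feasible extractor" by (simp add: feasible_def extractor_def sum_2)
  \<comment> \<open>Neither the allocation nor a bidder's payment depends on that bidder's own
    report.\<close>
  moreover have "dsic extractor"
    using exhaust_2 by (auto simp: dsic_def extractor_def utility_def)
  moreover have "interim_ir (perturbed n e) extractor"
    unfolding interim_ir_iff[OF finite_perturbed]
  proof (intro allI ballI)
    fix l :: 2 and t
    assume t: "t \<in> types (perturbed n e) l"
    consider "l = 1" | "l = 2" using exhaust_2 by blast
    then show "0 \<le> (\<Sum>v\<in>{v\<in>set_pmf (perturbed n e). v l = t}. pmf (perturbed n e) v * utility extractor l t v)"
    proof cases
      case 1
      then obtain i where i: "i \<le> n" "t = 2 ^ i" using t by (auto simp: types_perturbed)
      \<comment> \<open>Interim IR of bidder 1 holds with equality, although single payments may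
        exceed the value.\<close>
      have "(\<Sum>j\<le>n. cell n e i j * utility extractor 1 (2 ^ i) (profile2 i j)) =
          (\<Sum>j\<le>n. cell n e i j) * 2 ^ i - (\<Sum>j\<le>n. cell n e i j * pay extractor 1 (profile2 i j))"
        by (simp add: utility_def right_diff_distrib sum_subtractf sum_distrib_right)
          (simp add: extractor_def)
      also have "\<dots> = 0" by (simp add: sum_cell_extractor sum_cell_snd_one i)
      finally show ?thesis by (simp add: 1 i interim_sum_perturbed)
    next
      case 2
      then show ?thesis by (simp add: utility_def extractor_def)
    qed
  qed
  moreover have "revenue (perturbed n e) extractor = real n / 2 + 1"
  proof -
    have "measure_pmf.expectation (perturbed n e) (pay extractor 1) = real n / 2 + 1"
      by (simp add: expectation_perturbed sum_cell_extractor sum_er_weight)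
    moreover have "pay extractor 2 = (\<lambda>_. 0)" by (simp add: extractor_def)
    ultimately show ?thesis by (simp add: revenue_def sum_2)
  qed
  ultimately show ?thesis
    using revenue_le_surplus unfolding is_optimal_revenue_def by blast
qed

end

section \<open>Opposite perturbations\<close>

lemma cell_add_cell_minus: "cell n e i j + cell n (- e) i j = 2 / real (Suc n) * er_weight n i"
  by (simp add: cell_def algebra_simps add_divide_distrib diff_divide_distrib del: of_nat_Suc)

text \<open>Only diagonal cells gain probability when \<open>- e\<close> is replaced by
  \<open>e\<close>, each at most \<open>2 * e * er_weight n i\<close>, and the weights sum up to
  1.\<close>

lemma expectation_perturbed_minus_le:
  assumes "perturbation n e" and "0 < e" and g: "\<And>x. 0 \<le> g x \<and> g x \<le> 1"
  shows "measure_pmf.expectation (perturbed n e) g \<le> measure_pmf.expectation (perturbed n (- e)) g + 2 * e"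
proof -
  interpret p: perturbation n e by fact
  interpret m: perturbation n "- e" using p.e_nz p.e_small by unfold_locales auto
  have "measure_pmf.expectation (perturbed n e) g - measure_pmf.expectation (perturbed n (- e)) g
      = (\<Sum>i\<le>n. \<Sum>j\<le>n. (cell n e i j - cell n (- e) i j) * g (profile2 i j))"
    by (simp add: p.expectation_perturbed m.expectation_perturbed sum_subtractf left_diff_distrib)
  also have "\<dots> \<le> (\<Sum>i\<le>n. \<Sum>j\<le>n. if i = j then 2 * e * er_weight n i else 0)"
  proof (intro sum_mono)
    fix i j
    let ?d = "cell n e i j - cell n (- e) i j"
    have d: "?d = 2 * e * er_weight n i * ((if i = j then 1 else 0) - 1 / real (Suc n))"
      by (simp add: cell_def algebra_simps add_divide_distrib diff_divide_distrib del: of_nat_Suc)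
    have w: "0 < 2 * e * er_weight n i" using \<open>0 < e\<close> er_weight_pos[of n i] by simp
    have "?d \<le> (if i = j then 2 * e * er_weight n i else 0)"
      unfolding d using mult_left_mono[of "(if i = j then 1 else 0) - 1 / real (Suc n)" "if i = j then 1 else 0", OF _ less_imp_le[OF w]] by (auto split: if_splits)
    \<comment> \<open>A [0,1]-valued test gains at most the positive part of the difference.\<close>
    moreover have "?d * g (profile2 i j) \<le> max 0 ?d"
    proof (cases "0 \<le> ?d")
      case True
      then show ?thesis using g by (simp add: mult_left_le)
    next
      case False
      then have "?d * g (profile2 i j) \<le> 0" using g by (intro mult_nonpos_nonneg) auto
      then show ?thesis by simp
    qed
    ultimately show "?d * g (profile2 i j) \<le> (if i = j then 2 * e * er_weight n i else 0)"
      using w by (smt (verit))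
  qed
  also have "\<dots> = 2 * e"
    by (simp add: sum_distrib_left[symmetric] sum_er_weight_one)
  finally show ?thesis by simp
qed

text \<open>Adding the two distributions makes \<open>j\<close> uniform and independent of
  \<open>i\<close>. The DSIC constraints, which hold for each \<open>j\<close>, can then be averaged
  with the same weights for all types, which reduces the claim to
  \<open>equal_revenue_bound\<close>.\<close>

lemma expected_pay_1_sum_le:
  assumes "perturbation n e" and A: "feasible A" and ic: "dsic A"
    and ir: "interim_ir (perturbed n e) A" and ir': "interim_ir (perturbed n (- e)) A"
  shows "measure_pmf.expectation (perturbed n e) (pay A 1)
    + measure_pmf.expectation (perturbed n (- e)) (pay A 1) \<le> 2"
proof -
  interpret p: perturbation n e by fact
  interpret m: perturbation n "- e" using p.e_nz p.e_small by unfold_locales auto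
  \<comment> \<open>\<open>X i\<close> and \<open>Q i\<close> are \<open>n + 1\<close> times the
    interim allocation and payment of type \<open>2 ^ i\<close> under the averaged
    distribution.\<close>
  define X where "X i = (\<Sum>j\<le>n. alloc A 1 (profile2 i j))" for i
  define Q where "Q i = (\<Sum>j\<le>n. pay A 1 (profile2 i j))" for i
  have avg: "(\<Sum>j\<le>n. cell n e i j * f j) + (\<Sum>j\<le>n. cell n (- e) i j * f j) =
      2 / real (Suc n) * er_weight n i * (\<Sum>j\<le>n. f j)" for i and f :: "nat \<Rightarrow> real"
    by (simp only: sum.distrib[symmetric] distrib_right[symmetric] cell_add_cell_minus sum_distrib_left)
  \<comment> \<open>The lowest type is \<open>2 ^ 0 = 1\<close>; its two interim constraints are
    added.\<close>
  have "Q 0 \<le> X 0"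
  proof -
    let ?u = "\<lambda>j. utility A 1 1 (profile2 0 j)"
    have "1 \<in> types (perturbed n e) 1" "1 \<in> types (perturbed n (- e)) 1"
      by (auto simp: p.types_perturbed m.types_perturbed intro!: image_eqI[where x = 0])
    then have "0 \<le> (\<Sum>j\<le>n. cell n e 0 j * ?u j)" "0 \<le> (\<Sum>j\<le>n. cell n (- e) 0 j * ?u j)"
      using ir[unfolded interim_ir_iff[OF p.finite_perturbed], rule_format, of 1 1]
        ir'[unfolded interim_ir_iff[OF m.finite_perturbed], rule_format, of 1 1]
        p.interim_sum_perturbed[of 0 "utility A 1 1"] m.interim_sum_perturbed[of 0 "utility A 1 1"]
      by simp_all
    then have "0 \<le> 2 / real (Suc n) * er_weight n 0 * (\<Sum>j\<le>n. ?u j)"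
      using avg[of 0 ?u] by simp
    moreover have "0 < 2 / real (Suc n) * er_weight n 0"
      by (simp add: er_weight_pos)
    ultimately have "0 \<le> (\<Sum>j\<le>n. ?u j)"
      using zero_le_mult_iff by (smt (verit))
    then show ?thesis by (simp add: utility_def X_def Q_def sum_subtractf)
  qed
  \<comment> \<open>Type \<open>2 ^ Suc i\<close> does not gain by reporting \<open>2 ^ i\<close>,
    whatever bidder 2 reports.\<close>
  moreover have "Q (Suc i) - Q i \<le> 2 ^ Suc i * (X (Suc i) - X i)" for i
  proof -
    have "pay A 1 (profile2 (Suc i) j) - pay A 1 (profile2 i j)
        \<le> 2 ^ Suc i * (alloc A 1 (profile2 (Suc i) j) - alloc A 1 (profile2 i j))" for j
      using ic[unfolded dsic_def, rule_format, of 1 "profile2 (Suc i) j" "2 ^ i"]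
      by (simp add: utility_def profile2_upd right_diff_distrib del: power_Suc)
    then show ?thesis
      by (simp add: X_def Q_def sum_subtractf[symmetric] sum_distrib_left sum_mono del: power_Suc)
  qed
  ultimately have "(\<Sum>i\<le>n. er_weight n i * Q i) \<le> X n"
    by (intro equal_revenue_bound)
  also have "X n \<le> (\<Sum>j\<le>n. 1)"
    unfolding X_def using A by (intro sum_mono) (auto simp: feasible_def)
  finally have "2 / real (Suc n) * (\<Sum>i\<le>n. er_weight n i * Q i) \<le> 2 / real (Suc n) * (\<Sum>j\<le>n. 1)"
    by (rule mult_left_mono) simp
  also have "\<dots> = 2"
    by (simp del: of_nat_Suc)
  finally have "2 / real (Suc n) * (\<Sum>i\<le>n. er_weight n i * Q i) \<le> 2" .
  moreover have "measure_pmf.expectation (perturbed n e) (pay A 1)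
      + measure_pmf.expectation (perturbed n (- e)) (pay A 1)
      = 2 / real (Suc n) * (\<Sum>i\<le>n. er_weight n i * Q i)"
    by (simp only: p.expectation_perturbed m.expectation_perturbed sum.distrib[symmetric])
      (simp only: sum.distrib avg Q_def sum_distrib_left mult.assoc)
  ultimately show ?thesis by simp
qed

section \<open>Choice of the parameters and conclusion\<close>

theorem theorem2:
  fixes k :: nat and \<delta> \<alpha> :: real
  assumes "k > 0" and "\<delta> > 0" and "\<alpha> > 0"
  shows "\<exists>(D :: 2 profile pmf) (D' :: 2 profile pmf) OPT OPT'.
           valuation_dist D \<and> valuation_dist D' \<and>
           cremer_mclean D \<and> cremer_mclean D' \<and>
           indistinguishable k \<delta> D D' \<and>
           is_optimal_revenue D OPT \<and> is_optimal_revenue D' OPT' \<and>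
           \<not> (\<exists>A. feasible A \<and> dsic A \<and> interim_ir D A \<and> interim_ir D' A \<and>
                  revenue D A \<ge> \<alpha> * OPT \<and> revenue D' A \<ge> \<alpha> * OPT')"
proof -
  obtain n :: nat where n: "4 / \<alpha> < real n" using reals_Archimedean2 by blast
  \<comment> \<open>The first bound makes \<open>e\<close> and \<open>- e\<close> admissible; the
    second makes the \<open>k\<close> exchanges, at cost \<open>2 * e\<close> each, total at most
    \<open>\<delta>\<close>.\<close>
  define e where "e = min (1 / (2 * real (Suc n))) (\<delta> / (2 * real k))"
  have e: "0 < e" using assms by (simp add: e_def)
  have "real k * (2 * e) \<le> real k * (2 * (\<delta> / (2 * real k)))"
    by (intro mult_left_mono) (auto simp: e_def)
  then have ke: "real k * (2 * e) \<le> \<delta>" using \<open>k > 0\<close> by simp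
  have "e \<le> 1 / (2 * real (Suc n))" unfolding e_def by (rule min.cobounded1)
  then interpret p: perturbation n e using e by unfold_locales simp_all
  interpret m: perturbation n "- e" using p.e_nz p.e_small by unfold_locales auto
  have "indistinguishable k \<delta> (perturbed n e) (perturbed n (- e))"
    using ke by (rule indistinguishableI[rotated])
      (rule expectation_perturbed_minus_le[OF p.perturbation_axioms e])
  moreover have "\<not> (\<exists>A. feasible A \<and> dsic A \<and> interim_ir (perturbed n e) A \<and> interim_ir (perturbed n (- e)) A \<and>
      revenue (perturbed n e) A \<ge> \<alpha> * (real n / 2 + 1) \<and> revenue (perturbed n (- e)) A \<ge> \<alpha> * (real n / 2 + 1))"
  proof
    assume "\<exists>A. feasible A \<and> dsic A \<and> interim_ir (perturbed n e) A \<and> interim_ir (perturbed n (- e)) A \<and>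
      revenue (perturbed n e) A \<ge> \<alpha> * (real n / 2 + 1) \<and> revenue (perturbed n (- e)) A \<ge> \<alpha> * (real n / 2 + 1)"
    then obtain A where A: "feasible A" "dsic A" "interim_ir (perturbed n e) A" "interim_ir (perturbed n (- e)) A"
      and rev: "revenue (perturbed n e) A \<ge> \<alpha> * (real n / 2 + 1)"
        "revenue (perturbed n (- e)) A \<ge> \<alpha> * (real n / 2 + 1)" by blast
    have "\<alpha> * (real n + 2) \<le> revenue (perturbed n e) A + revenue (perturbed n (- e)) A"
      using rev by (simp add: algebra_simps)
    \<comment> \<open>Bidder 1 pays at most 2 over both distributions together, and bidder 2 at most
      1 under each.\<close>
    also have "\<dots> \<le> 4"
      using expected_pay_1_sum_le[OF p.perturbation_axioms A]
        p.expected_pay_2_le[OF A(1,3)] m.expected_pay_2_le[OF A(1,4)]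
      by (simp add: revenue_def sum_2)
    also have "\<dots> < \<alpha> * real n"
      using n \<open>\<alpha> > 0\<close> by (simp add: pos_divide_less_eq mult.commute)
    finally show False using \<open>\<alpha> > 0\<close> by (simp add: algebra_simps)
  qed
  ultimately show ?thesis
    using p.valuation_dist_perturbed m.valuation_dist_perturbed
      p.cremer_mclean_perturbed m.cremer_mclean_perturbed
      p.is_optimal_revenue_perturbed m.is_optimal_revenue_perturbed
    by blast
qed

end
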